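(* Let $n,k,a,b$ be integers with $n\geq k\geq 0$ and $a>b>0$. If $-1\leq k-(n+1)b/a\leq 0$, then the sequence $u_j=\binom{n+ja}{k+jb}$, $j=0,1,2,\ldots$, is log-convex, i.e. $u_{j+1}^2\leq u_j u_{j+2}$ for all $j\geq 0$. *)

theory Defs
  imports Complex_Main
begin

definition log_convex :: "(nat \<Rightarrow> real) \<Rightarrow> bool" where
  "log_convex u \<longleftrightarrow> (\<forall>j. (u (j + 1))\<^sup>2 \<le> u j * u (j + 2))"

end

theory Submission
  imports Defs
begin

text \<open>
  Shifting \<open>j\<close> does not change the hypothesis, so only \<open>j = 0\<close> matters. With \<open>m = n - k\<close> and
  \<open>c = a - b\<close>, the quotient \<open>u\<^sub>0 u\<^sub>2 / u\<^sub>1\<^sup>2\<close> is a product of the factors \<open>1 + 1/x\<close> over the points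
  \<open>x = (n + i)/a\<close>, \<open>1 \<le> i \<le> a\<close>, divided by the same product over the points \<open>(k + i)/b\<close>,
  \<open>1 \<le> i \<le> b\<close>, and \<open>(m + i)/c\<close>, \<open>1 \<le> i \<le> c\<close>. Both families have \<open>a = b + c\<close> members, and the
  hypothesis ensures that below any threshold \<open>y\<close> there are at least as many points of the
  first family as of the second. Hence the \<open>i\<close>-th smallest points compare, and so do the products,
  as \<open>1 + 1/x\<close> is decreasing.
\<close>

text \<open>Induction on the common cardinality: removing a point of largest value from each family
  pairs the families in sorted order without sorting them. Separate index types let a disjoint sum
  be compared with a single range.\<close>

lemma prod_mono_of_counting:
  fixes f :: "'a \<Rightarrow> real" and g :: "'b \<Rightarrow> real" and F :: "real \<Rightarrow> real"
  assumes "finite S" "finite T" "card S = card T"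
    and "\<And>y. card {x\<in>S. f x \<le> y} \<le> card {x\<in>T. g x \<le> y}"
    and "\<And>x. x \<in> S \<Longrightarrow> 0 < f x" "\<And>x. x \<in> T \<Longrightarrow> 0 < g x"
    and nonneg: "\<And>x. 0 < x \<Longrightarrow> 0 \<le> F x" and antimono: "\<And>x y. 0 < x \<Longrightarrow> x \<le> y \<Longrightarrow> F y \<le> F x"
  shows "(\<Prod>x\<in>S. F (f x)) \<le> (\<Prod>x\<in>T. F (g x))"
  using assms(1-6)
proof (induction "card S" arbitrary: S T)
  case 0
  then show ?case by simp
next
  case (Suc N)
  have ne: "S \<noteq> {}" "T \<noteq> {}" using Suc.hyps(2) Suc.prems(3) by auto
  have "Max (f ` S) \<in> f ` S" using ne Suc.prems(1) by simp
  then obtain s where "s \<in> S" "Max (f ` S) = f s" by blast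
  then have s: "s \<in> S" "\<And>x. x \<in> S \<Longrightarrow> f x \<le> f s"
    using Suc.prems(1) by (auto simp flip: \<open>Max (f ` S) = f s\<close>)
  have "Max (g ` T) \<in> g ` T" using ne Suc.prems(2) by simp
  then obtain t where "t \<in> T" "Max (g ` T) = g t" by blast
  then have t: "t \<in> T" "\<And>x. x \<in> T \<Longrightarrow> g x \<le> g t"
    using Suc.prems(2) by (auto simp flip: \<open>Max (g ` T) = g t\<close>)
  \<comment> \<open>The threshold \<open>f s\<close> counts all of \<open>S\<close>, hence by equal
    cardinality all of \<open>T\<close>; so the largest value of \<open>g\<close> is at most that of
    \<open>f\<close>.\<close>
  have "{x\<in>S. f x \<le> f s} = S" using s by auto
  then have "card T \<le> card {x\<in>T. g x \<le> f s}" using Suc.prems(3) Suc.prems(4)[of "f s"] by simp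
  then have "{x\<in>T. g x \<le> f s} = T" using Suc.prems(2) by (intro card_seteq) auto
  then have le: "g t \<le> f s" using t(1) by auto
  have count: "card {x\<in>S - {s}. f x \<le> y} \<le> card {x\<in>T - {t}. g x \<le> y}" for y
  \<comment> \<open>From \<open>g t\<close> upwards all of \<open>T - {t}\<close> is counted and
    cardinality suffices. Below \<open>g t\<close>, neither removed point was counted, because
    \<open>g t \<le> f s\<close>.\<close>
  proof (cases "g t \<le> y")
    case True
    then have "{x\<in>T - {t}. g x \<le> y} = T - {t}" using t(2) by force
    moreover have "card {x\<in>S - {s}. f x \<le> y} \<le> card (S - {s})"
      using Suc.prems(1) by (intro card_mono) auto
    ultimately show ?thesis using s(1) t(1) Suc.prems(3) by simp
  next
    case False
    then have "{x\<in>T - {t}. g x \<le> y} = {x\<in>T. g x \<le> y}" 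
      "{x\<in>S - {s}. f x \<le> y} = {x\<in>S. f x \<le> y}" using le by auto
    then show ?thesis using Suc.prems(4)[of y] by simp
  qed
  have IH: "(\<Prod>x\<in>S - {s}. F (f x)) \<le> (\<Prod>x\<in>T - {t}. F (g x))"
    using Suc.hyps(2) Suc.prems s(1) t(1) count by (intro Suc.hyps(1)) auto
  have "F (f s) * (\<Prod>x\<in>S - {s}. F (f x)) \<le> F (g t) * (\<Prod>x\<in>T - {t}. F (g x))"
    using IH le Suc.prems(5,6) s(1) t(1) nonneg antimono
    by (intro mult_mono prod_nonneg) auto
  then show ?case
    by (simp only: prod.remove[OF Suc.prems(1) s(1)] prod.remove[OF Suc.prems(2) t(1)])
qed

text \<open>A downward closed predicate cuts out an initial segment of the indices, so the count is
  its first failing index and the predecessor its last valid one. This turns counts into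
  inequalities for the threshold.\<close>

lemma card_initial_segment:
  fixes P :: "nat \<Rightarrow> bool"
  assumes down: "\<And>i j. P j \<Longrightarrow> i \<le> j \<Longrightarrow> P i"
  shows "card {i\<in>{..<a}. P i} < a \<Longrightarrow> \<not> P (card {i\<in>{..<a}. P i})"
    and "0 < card {i\<in>{..<a}. P i} \<Longrightarrow> P (card {i\<in>{..<a}. P i} - 1)"
proof -
  define A where "A = card {i\<in>{..<a}. P i}"
  have "\<not> P A" if "A < a"
  proof
    assume "P A"
    then have "P i" if "i \<le> A" for i using that by (rule down)
    then have "{..A} \<subseteq> {i\<in>{..<a}. P i}" using \<open>A < a\<close> by auto
    then have "card {..A} \<le> A" unfolding A_def by (intro card_mono) auto
    then show False by simp
  qed
  then show "card {i\<in>{..<a}. P i} < a \<Longrightarrow> \<not> P (card {i\<in>{..<a}. P i})"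
    unfolding A_def .
  have "P (A - 1)" if "0 < A"
  proof (rule ccontr)
    assume "\<not> P (A - 1)"
    then have "i < A - 1" if "P i" for i using down[OF that, of "A - 1"] by linarith
    then have "{i\<in>{..<a}. P i} \<subseteq> {..<A - 1}" by blast
    then have "A \<le> card {..<A - 1}" unfolding A_def by (intro card_mono) auto
    then show False using that by simp
  qed
  then show "0 < card {i\<in>{..<a}. P i} \<Longrightarrow> P (card {i\<in>{..<a}. P i} - 1)"
    unfolding A_def .
qed

lemma count_points_le:
  fixes n m k a b c :: nat and y :: real
  assumes n: "n = k + m" and a: "a = b + c" and "0 < b" "0 < c"
    and lo: "(n + 1) * b \<le> (k + 1) * a" and hi: "k * a \<le> (n + 1) * b"
  shows "card {i\<in>{..<b}. real (k + 1 + i) / b \<le> y} + card {i\<in>{..<c}. real (m + 1 + i) / c \<le> y}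
    \<le> card {i\<in>{..<a}. real (n + 1 + i) / a \<le> y}"
proof -
  define A where "A = card {i\<in>{..<a}. real (n + 1 + i) / a \<le> y}"
  define B where "B = card {i\<in>{..<b}. real (k + 1 + i) / b \<le> y}"
  define C where "C = card {i\<in>{..<c}. real (m + 1 + i) / c \<le> y}"
  have down: "real (p + 1 + i) / q \<le> y" if "real (p + 1 + j) / q \<le> y" "i \<le> j" for p q i j :: nat
    using that by (smt (verit) divide_right_mono of_nat_0_le_iff of_nat_add of_nat_le_iff)
  have card_le: "card {i\<in>{..<q}. P i} \<le> q" for q :: nat and P
    using card_mono[of "{..<q}" "{i\<in>{..<q}. P i}"] by auto
  have pos: "0 < a" using a assms(3) by simp
  \<comment> \<open>Index \<open>A\<close> is the first uncounted one.\<close>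
  have Ay: "a * y < real (n + 1 + A)" if "A < a"
    using card_initial_segment(1)[of "\<lambda>i. real (n + 1 + i) / a \<le> y" a] that down pos
    unfolding A_def by (auto simp: field_simps not_le)
  \<comment> \<open>Index \<open>B - 1\<close> is the last counted one, and its point is
    \<open>(k + B) / b\<close>; likewise for \<open>C\<close>.\<close>
  have By: "real (k + B) \<le> b * y" if "0 < B"
    using card_initial_segment(2)[of "\<lambda>i. real (k + 1 + i) / b \<le> y" b] that down assms(3)
    unfolding B_def[symmetric] by (auto simp: field_simps of_nat_diff)
  have Cy: "real (m + C) \<le> c * y" if "0 < C"
    using card_initial_segment(2)[of "\<lambda>i. real (m + 1 + i) / c \<le> y" c] that down assms(4)
    unfolding C_def[symmetric] by (auto simp: field_simps of_nat_diff)
  \<comment> \<open>When one of the two families has no point below \<open>y\<close>, the count of the other is bounded by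
    the hypothesis on its offset alone.\<close>
  have single: "D \<le> A" if "A < a" "real (p + D) \<le> q * y" "(n + 1) * q \<le> (p + 1) * a" "0 < q" "q \<le> a"
    for p q D :: nat
  proof -
    have "a * real (p + D) \<le> a * (q * y)" using that by (intro mult_left_mono) auto
    also have "\<dots> = q * (a * y)" by simp
    also have "\<dots> < q * real (n + 1 + A)" using Ay[OF that(1)] that(4) by simp
    finally have "real (a * (p + D)) < real (q * (n + 1 + A))" by (simp only: of_nat_mult)
    then have "a * (p + D) < q * (n + 1 + A)" by (simp only: of_nat_less_iff)
    moreover have "q * A \<le> a * A" using that(5) by (rule mult_le_mono1)
    ultimately have "a * D < a * (A + 1)" 
      using that(3) unfolding distrib_left distrib_right by (simp only: mult.commute)
    then have "D < A + 1" by (simp only: mult_less_cancel1)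
    then show ?thesis by simp
  qed
  have "B + C \<le> A"
  proof (cases "A < a")
    case False
    moreover have "B \<le> b" "C \<le> c" unfolding B_def C_def by (rule card_le)+
    ultimately show ?thesis using a by simp
  next
    case True
    consider "0 < B" "0 < C" | "B = 0" "C = 0" | "0 < B" "C = 0" | "B = 0" "0 < C" by auto
    then show ?thesis
    proof cases
      case 1
      \<comment> \<open>The offsets add up to \<open>n\<close> and the steps to \<open>a\<close>;
        integrality then absorbs the extra 1 in the strict bound on \<open>a * y\<close>.\<close>
      then have "real (n + B + C) \<le> a * y" using By Cy n a by (simp add: algebra_simps)
      then have "real (n + B + C) < real (n + 1 + A)" using Ay[OF True] by linarith
      then show ?thesis by simp
    next
      case 3
      then show ?thesis using single[OF True By lo assms(3)] a by simp
    next
      case 4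
      \<comment> \<open>Subtracting \<open>hi\<close> from \<open>(n + 1) * a\<close> gives the
        analogue of \<open>lo\<close> for the complementary pair \<open>m\<close>,
        \<open>c\<close>.\<close>
      have "(n + 1) * c \<le> (m + 1) * a" using hi n a by (simp add: algebra_simps)
      then show ?thesis using single[OF True Cy] 4 assms(4) a by simp
    qed simp
  qed
  then show ?thesis unfolding A_def B_def C_def .
qed

text \<open>Each factor is \<open>(n + a + 1 + i) / (n + 1 + i)\<close>, so numerators and
  denominators form two adjacent blocks of consecutive integers.\<close>

lemma prod_eq_fact_quotient:
  fixes n a :: nat
  assumes "0 < a"
  shows "(\<Prod>i<a. 1 + 1 / (real (n + 1 + i) / a)) = fact (n + 2 * a) * fact n / (fact (n + a))\<^sup>2"
proof -
  have fact_add: "fact (p + q) = (fact p :: real) * (\<Prod>i<q. real (p + 1 + i))" for p q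
    by (induction q) (auto simp: algebra_simps)
  have "(\<Prod>i<a. 1 + 1 / (real (n + 1 + i) / a))
      = (\<Prod>i<a. real (n + a + 1 + i)) / (\<Prod>i<a. real (n + 1 + i))"
    unfolding prod_dividef[symmetric] by (intro prod.cong) (auto simp: field_simps)
  also have "\<dots> = (fact (n + a + a) / fact (n + a)) / (fact (n + a) / fact n)"
    unfolding fact_add[of "n + a" a] fact_add[of n a] by simp
  finally show ?thesis by (simp add: power2_eq_square mult_2 add.assoc)
qed

lemma choose_sq_le:
  fixes n m k a b c :: nat
  assumes n: "n = k + m" and a: "a = b + c" and bc: "0 < b" "0 < c"
    and "(n + 1) * b \<le> (k + 1) * a" and "k * a \<le> (n + 1) * b"
  shows "(real ((n + a) choose (k + b)))\<^sup>2 \<le> real (n choose k) * real ((n + 2 * a) choose (k + 2 * b))"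
proof -
  let ?F = "\<lambda>x :: real. 1 + 1 / x"
  let ?g = "\<lambda>p q i. real (p + 1 + i) / real q"
  let ?f = "case_sum (?g k b) (?g m c)"
  let ?S = "{..<b} <+> {..<c}"
  have count: "card {x\<in>?S. ?f x \<le> y} \<le> card {i\<in>{..<a}. ?g n a i \<le> y}" for y
  proof -
    have "{x\<in>?S. ?f x \<le> y} = {i\<in>{..<b}. ?g k b i \<le> y} <+> {i\<in>{..<c}. ?g m c i \<le> y}"
      by auto
    then show ?thesis using count_points_le[OF assms, of y] by (simp add: card_Plus)
  qed
  have "(\<Prod>x\<in>?S. ?F (?f x)) \<le> (\<Prod>i<a. ?F (?g n a i))"
    using bc a by (intro prod_mono_of_counting count) (auto simp: card_Plus frac_le)
  then have "(\<Prod>i<b. ?F (?g k b i)) * (\<Prod>i<c. ?F (?g m c i)) \<le> (\<Prod>i<a. ?F (?g n a i))"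
    by (simp add: prod.Plus)
  moreover have "0 < a" using bc a by simp
  ultimately have le: "(fact (k + 2 * b) * fact k / (fact (k + b))\<^sup>2) * (fact (m + 2 * c) * fact m / (fact (m + c))\<^sup>2)
      \<le> (fact (n + 2 * a) * fact n / (fact (n + a))\<^sup>2 :: real)"
    using bc by (simp only: prod_eq_fact_quotient)
  have choose: "real ((p + q) choose p) = fact (p + q) / (fact p * fact q)" for p q
    by (subst binomial_fact) auto
  have c0: "real (n choose k) = fact n / (fact k * fact m)"
    using choose[of k m] n by simp
  have c1: "real ((n + a) choose (k + b)) = fact (n + a) / (fact (k + b) * fact (m + c))"
    using choose[of "k + b" "m + c"] n a by (simp add: algebra_simps)
  have c2: "real ((n + 2 * a) choose (k + 2 * b)) = fact (n + 2 * a) / (fact (k + 2 * b) * fact (m + 2 * c))"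
    using choose[of "k + 2 * b" "m + 2 * c"] n a by (simp add: algebra_simps)
  \<comment> \<open>Multiplying the comparison of factorial quotients by
    \<open>N1\<^sup>2 / (K2 * K0 * (M2 * M0))\<close> regroups it into binomial
    coefficients.\<close>
  have cross: "(N1 / (K1 * M1))\<^sup>2 \<le> (N0 / (K0 * M0)) * (N2 / (K2 * M2))"
    if "(K2 * K0 / K1\<^sup>2) * (M2 * M0 / M1\<^sup>2) \<le> N2 * N0 / N1\<^sup>2"
      "0 < K0" "0 < K1" "0 < K2" "0 < M0" "0 < M1" "0 < M2" "0 < N1"
    for K0 K1 K2 M0 M1 M2 N0 N1 N2 :: real
  proof -
    have "(N1 / (K1 * M1))\<^sup>2
        = (K2 * K0 / K1\<^sup>2) * (M2 * M0 / M1\<^sup>2) * (N1\<^sup>2 / (K2 * K0 * (M2 * M0)))"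
      using that(2-8) by (simp add: power_mult_distrib power_divide)
    also have "\<dots> \<le> N2 * N0 / N1\<^sup>2 * (N1\<^sup>2 / (K2 * K0 * (M2 * M0)))"
      using that by (intro mult_right_mono) auto
    also have "\<dots> = (N0 / (K0 * M0)) * (N2 / (K2 * M2))"
      using that(2-8) by (simp add: mult_ac)
    finally show ?thesis .
  qed
  show ?thesis unfolding c0 c1 c2 by (rule cross[OF le]) simp_all
qed

theorem theorem1:
  fixes n k a b :: nat
  assumes "k \<le> n" and "0 < b" and "b < a"
    and "-1 \<le> real k - (real n + 1) * real b / real a"
    and "real k - (real n + 1) * real b / real a \<le> 0"
  shows "log_convex (\<lambda>j. real ((n + j * a) choose (k + j * b)))"
  unfolding log_convex_def
proof
  fix j
  have "real ((n + 1) * b) \<le> real ((k + 1) * a)" "real (k * a) \<le> real ((n + 1) * b)"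
    using assms(2-5) by (simp_all add: field_simps)
  then have lo: "(n + 1) * b \<le> (k + 1) * a" and hi: "k * a \<le> (n + 1) * b"
    by (simp_all only: of_nat_le_iff)
  obtain m where m: "n = k + m" using assms(1) le_Suc_ex by blast
  obtain c where c: "a = b + c" using assms(3) less_imp_add_positive by blast
  have "(real ((n + j * a + a) choose (k + j * b + b)))\<^sup>2
      \<le> real ((n + j * a) choose (k + j * b)) * real ((n + j * a + 2 * a) choose (k + j * b + 2 * b))"
  proof (rule choose_sq_le[where m = "m + j * c" and c = c])
    \<comment> \<open>The shift adds \<open>j * a * b\<close> to both sides of each
      inequality.\<close>
    show "(n + j * a + 1) * b \<le> (k + j * b + 1) * a" "(k + j * b) * a \<le> (n + j * a + 1) * b"
      using lo hi by (simp_all add: algebra_simps)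
  qed (use m c assms in \<open>simp_all add: algebra_simps\<close>)
  then show "(real ((n + (j + 1) * a) choose (k + (j + 1) * b)))\<^sup>2
      \<le> real ((n + j * a) choose (k + j * b)) * real ((n + (j + 2) * a) choose (k + (j + 2) * b))"
    by (simp only: add_mult_distrib add.assoc mult_1)
qed

end
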